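(* Let $\pi'\subset \operatorname{Im}\mathbb{O}\cong\mathbb{R}^7$ be an affine $3$-plane such that $S^2_r=\pi'\cap S^6$ is a two-dimensional sphere of radius $r\in(0,1]$, and let $\pi$ be the $3$-dimensional linear subspace of $\operatorname{Im}\mathbb{O}$ parallel to $\pi'$. (a) If $S^2_r=S^2_1$ is a great sphere, that is $\pi=\pi'$, then it is slant in $S^6$ with slant angle $\theta=\arccos\phi(\pi)$. Therefore $S^2_1$ is a proper slant sphere if $\pi$ is not associative. (b) If $\pi$ is associative, then the small sphere $S^2_r$ ($r<1$) is slant with slant angle $\theta=\arccos r$. (c) If $\pi$ is not associative, then the small sphere $S^2_r$ ($r<1$) is slant with slant angle $\theta=\arccos(r\,\phi(\pi))$ if and only if its center is the point $$C=\pm\frac{\sqrt{1-r^2}}{\|[\pi]\|}\,[\pi].$$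
   Context: $\mathbb{O}=\mathbb{H}\oplus\mathbb{H}$ is the algebra of octonions with product $(q,r)\cdot(s,t)=(qs-\overline{t}r,\;tq+r\overline{s})$, conjugation $\overline{(q,r)}=(\overline q,-r)$ and inner product $\langle x,y\rangle=\frac12(x\overline y+y\overline x)$. $\operatorname{Im}\mathbb{O}=\{x: x+\overline x=0\}\cong\mathbb{R}^7$, and $S^6$ is the unit sphere in $\operatorname{Im}\mathbb{O}$. The almost complex structure on $S^6$ is $J_p(X)=p\cdot X$ (octonionic product) for $p\in S^6$, $X\in T_pS^6$; with the induced metric, $S^6$ is an almost Hermitian manifold. For a submanifold $N$ of an almost Hermitian manifold $(M,g,J)$, $p\in N$ and nonzero $X\in T_pN$, the Wirtinger angle is $\theta_p(X)=\angle(JX,T_pN)$. $N$ is slant if this angle is a constant $\theta$, independent of $p$ and $X$; $\theta$ is then the slant angle. $N$ is almost complex if $\theta=0$, totally real if $\theta=\pi/2$ (here $\pi$ is the number), and proper slant if it is slant but neither almost complex nor totally real. The associator is $[x,y,z]=(xy)z-x(yz)$, and the associative $3$-form on $\operatorname{Im}\mathbb{O}$ is $\phi(x,y,z)=\langle x,yz\rangle$. For a $3$-dimensional linear subspace $\pi\subset\operatorname{Im}\mathbb{O}$ with orthonormal basis $f_1,f_2,f_3$, put $\phi(\pi)=|\phi(f_1,f_2,f_3)|$ and $[\pi]=[f_1,f_2,f_3]$. The number $\phi(\pi)\in[0,1]$ is independent of the basis, and $[\pi]$ is well defined up to sign. The plane $\pi$ is called associative if it is the imaginary part of a quaternionic subalgebra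 of $\mathbb{O}$ (equivalently $\phi(\pi)=1$).
   Formalization: In (a), "proper slant if π is not associative" is proved only when φ(π) ≠ 0 (if φ(π) = 0 the great sphere is totally real, so not proper slant); for every non-associative π it is shown not almost complex. *)

theory Defs
  imports "HOL-Analysis.Analysis"
begin

text \<open>
  The quaternions are pairs of complex numbers, with \<open>(a, b)\<close> standing for \<open>a + b j\<close>, and the
  octonions are pairs of quaternions. Using product types, the real vector space structure, the
  Euclidean inner product and the norm are the library ones; \<open>octo_inner\<close> below shows that
  the inner product of the octonions is the library's \<open>\<bullet>\<close>.
\<close>

type_synonym quat = "complex \<times> complex"
type_synonym octo = "quat \<times> quat"

definition quat_mult :: "quat \<Rightarrow> quat \<Rightarrow> quat" (infixl "\<cdot>\<^sub>H" 70) where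
  "x \<cdot>\<^sub>H y = (fst x * fst y - snd x * cnj (snd y), fst x * snd y + snd x * cnj (fst y))"

definition quat_cnj :: "quat \<Rightarrow> quat" where
  "quat_cnj x = (cnj (fst x), - snd x)"

definition quat_one :: quat where
  "quat_one = (1, 0)"

definition octo_mult :: "octo \<Rightarrow> octo \<Rightarrow> octo" (infixl "\<cdot>\<^sub>O" 70) where
  "x \<cdot>\<^sub>O y =
     (fst x \<cdot>\<^sub>H fst y - quat_cnj (snd y) \<cdot>\<^sub>H snd x,
      snd y \<cdot>\<^sub>H fst x + snd x \<cdot>\<^sub>H quat_cnj (fst y))"

definition octo_cnj :: "octo \<Rightarrow> octo" where
  "octo_cnj x = (quat_cnj (fst x), - snd x)"

definition octo_one :: octo where
  "octo_one = (quat_one, 0)"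

lemma octo_inner:
  "(1 / 2) *\<^sub>R (x \<cdot>\<^sub>O octo_cnj y + y \<cdot>\<^sub>O octo_cnj x) = (x \<bullet> y) *\<^sub>R octo_one"
  by (simp add: octo_mult_def octo_cnj_def octo_one_def quat_mult_def quat_cnj_def quat_one_def
      prod_eq_iff inner_prod_def inner_complex_def complex_eq_iff field_simps)

definition ImO :: "octo set" where
  "ImO = {x. x + octo_cnj x = 0}"

definition S6 :: "octo set" where
  "S6 = ImO \<inter> sphere 0 1"

definition associator :: "octo \<Rightarrow> octo \<Rightarrow> octo \<Rightarrow> octo" where
  "associator x y z = (x \<cdot>\<^sub>O y) \<cdot>\<^sub>O z - x \<cdot>\<^sub>O (y \<cdot>\<^sub>O z)"

definition assoc_form :: "octo \<Rightarrow> octo \<Rightarrow> octo \<Rightarrow> real" where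
  "assoc_form x y z = x \<bullet> (y \<cdot>\<^sub>O z)"

definition quaternionic_subalgebra :: "octo set \<Rightarrow> bool" where
  "quaternionic_subalgebra A \<longleftrightarrow>
     (\<exists>h. linear h \<and> inj h \<and> h quat_one = octo_one \<and>
          (\<forall>q s. h (q \<cdot>\<^sub>H s) = h q \<cdot>\<^sub>O h s) \<and> A = range h)"

definition associative_plane :: "octo set \<Rightarrow> bool" where
  "associative_plane P \<longleftrightarrow> (\<exists>A. quaternionic_subalgebra A \<and> P = A \<inter> ImO)"

definition orthonormal_basis3 :: "'a::euclidean_space \<Rightarrow> 'a \<Rightarrow> 'a \<Rightarrow> 'a set \<Rightarrow> bool" where
  "orthonormal_basis3 f1 f2 f3 P \<longleftrightarrow>
     norm f1 = 1 \<and> norm f2 = 1 \<and> norm f3 = 1 \<and>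
     f1 \<bullet> f2 = 0 \<and> f1 \<bullet> f3 = 0 \<and> f2 \<bullet> f3 = 0 \<and> span {f1, f2, f3} = P"

text \<open>
  The tangent space of a submanifold of a Euclidean space consists of the velocities of the curves
  in it. For an embedded submanifold, requiring differentiability only at \<open>0\<close> gives the same
  vectors as smooth curves.
\<close>

definition tangent_space :: "'a::euclidean_space set \<Rightarrow> 'a \<Rightarrow> 'a set" where
  "tangent_space N p =
     {v. \<exists>\<gamma>::real \<Rightarrow> 'a. \<gamma> 0 = p \<and> (\<forall>\<^sub>F t in nhds 0. \<gamma> t \<in> N) \<and>
           (\<gamma> has_vector_derivative v) (at 0)}"

definition vec_angle :: "'a::euclidean_space \<Rightarrow> 'a \<Rightarrow> real" where
  "vec_angle v w = arccos (v \<bullet> w / (norm v * norm w))"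

text \<open>Meaningful for \<open>v \<noteq> 0\<close> and \<open>W \<noteq> {0}\<close>; the value then lies in \<open>[0, pi/2]\<close>.\<close>

definition subspace_angle :: "'a::euclidean_space \<Rightarrow> 'a set \<Rightarrow> real" where
  "subspace_angle v W = (INF w \<in> W - {0}. vec_angle v w)"

definition J :: "octo \<Rightarrow> octo \<Rightarrow> octo" where
  "J p X = p \<cdot>\<^sub>O X"

text \<open>
  The following notions are for submanifolds \<open>N\<close> of \<open>S6\<close>. The metric of \<open>S6\<close> is induced from the
  Euclidean one, so angles between tangent vectors are Euclidean angles.
\<close>

definition wirtinger_angle :: "octo set \<Rightarrow> octo \<Rightarrow> octo \<Rightarrow> real" where
  "wirtinger_angle N p X = subspace_angle (J p X) (tangent_space N p)"

definition slant_with_angle :: "octo set \<Rightarrow> real \<Rightarrow> bool" where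
  "slant_with_angle N \<theta> \<longleftrightarrow>
     (\<forall>p\<in>N. \<forall>X\<in>tangent_space N p - {0}. wirtinger_angle N p X = \<theta>)"

definition slant :: "octo set \<Rightarrow> bool" where
  "slant N \<longleftrightarrow> (\<exists>\<theta>. slant_with_angle N \<theta>)"

definition almost_complex :: "octo set \<Rightarrow> bool" where
  "almost_complex N \<longleftrightarrow> slant_with_angle N 0"

definition totally_real :: "octo set \<Rightarrow> bool" where
  "totally_real N \<longleftrightarrow> slant_with_angle N (pi / 2)"

definition proper_slant :: "octo set \<Rightarrow> bool" where
  "proper_slant N \<longleftrightarrow> slant N \<and> \<not> almost_complex N \<and> \<not> totally_real N"

end

theory Submission
  imports Defs
begin

text \<open>
  Write the points of the sphere as \<open>p = C + r n\<close>, with \<open>n\<close> a unit vector of the plane and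
  \<open>C\<close> orthogonal to it, and let \<open>(n, x, w)\<close> be a positively oriented orthonormal basis of the
  plane, so that \<open>x, w\<close> span the tangent space at \<open>p\<close>. Since \<open>p x\<close> is a unit vector orthogonal to
  \<open>x\<close>, the cosine of the Wirtinger angle is the absolute value of the inner product of \<open>p x\<close> and
  \<open>w\<close>. This is an affine function of \<open>n\<close>, namely \<open>c \<bullet> n + r \<phi>\<close>, where \<open>c\<close> has the components of
  \<open>C\<close> along \<open>f2 f3\<close>, \<open>f3 f1\<close>, \<open>f1 f2\<close>. Its absolute value is \<open>r \<bar>\<phi>\<bar>\<close> for all \<open>n\<close> only if
  \<open>c = 0\<close>. If \<open>\<phi>\<^sup>2 \<noteq> 1\<close>, the vectors \<open>1, f1, f2, f3, f2 f3, f3 f1, f1 f2\<close> are independent and the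
  associator spans their orthogonal complement; if \<open>\<phi>\<^sup>2 = 1\<close>, the plane is closed under the vector
  product, hence associative.
\<close>

section \<open>Octonion identities and imaginary octonions\<close>

text \<open>The two adjoint rules and the two cancellation laws are polynomial identities, checked
  in coordinates. The composition property of the norm and the alternative laws for imaginary
  elements follow from them without further coordinates.\<close>

lemma octo_mult_adjoint_left: "(x \<cdot>\<^sub>O y) \<bullet> z = y \<bullet> (octo_cnj x \<cdot>\<^sub>O z)"
  by (simp add: octo_mult_def octo_cnj_def quat_mult_def quat_cnj_def
      inner_prod_def inner_complex_def algebra_simps)

lemma octo_mult_adjoint_right: "(x \<cdot>\<^sub>O y) \<bullet> z = x \<bullet> (z \<cdot>\<^sub>O octo_cnj y)"
  by (simp add: octo_mult_def octo_cnj_def quat_mult_def quat_cnj_def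
      inner_prod_def inner_complex_def algebra_simps)

lemma octo_cnj_mult_cancel_left: "octo_cnj x \<cdot>\<^sub>O (x \<cdot>\<^sub>O y) = (x \<bullet> x) *\<^sub>R y"
  by (simp add: octo_mult_def octo_cnj_def quat_mult_def quat_cnj_def prod_eq_iff complex_eq_iff
      inner_prod_def inner_complex_def algebra_simps)

lemma octo_cnj_mult_cancel_right: "(y \<cdot>\<^sub>O x) \<cdot>\<^sub>O octo_cnj x = (x \<bullet> x) *\<^sub>R y"
  by (simp add: octo_mult_def octo_cnj_def quat_mult_def quat_cnj_def prod_eq_iff complex_eq_iff
      inner_prod_def inner_complex_def algebra_simps)

lemma octo_one_mult [simp]: "octo_one \<cdot>\<^sub>O x = x" "x \<cdot>\<^sub>O octo_one = x"
  by (simp_all add: octo_mult_def octo_one_def quat_one_def quat_mult_def quat_cnj_def prod_eq_iff)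

lemma octo_one_inner_self [simp]: "octo_one \<bullet> octo_one = 1"
  by (simp add: octo_one_def quat_one_def inner_prod_def)

lemma bilinear_octo_mult: "bilinear octo_mult"
  by (auto simp add: bilinear_def linear_iff octo_mult_def quat_mult_def quat_cnj_def
      prod_eq_iff complex_eq_iff algebra_simps)

interpretation octo_mult: bounded_bilinear octo_mult
  using bilinear_octo_mult bilinear_conv_bounded_bilinear by blast

lemmas octo_mult_linear =
  octo_mult.add_left octo_mult.add_right octo_mult.diff_left octo_mult.diff_right
  octo_mult.scaleR_left octo_mult.scaleR_right octo_mult.minus_left octo_mult.minus_right

lemma ImO_iff: "x \<in> ImO \<longleftrightarrow> x \<bullet> octo_one = 0"
  by (simp add: ImO_def octo_cnj_def quat_cnj_def octo_one_def quat_one_def prod_eq_iff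
      complex_eq_iff inner_prod_def inner_complex_def)

lemma subspace_ImO: "subspace ImO"
  by (auto simp: subspace_def ImO_iff inner_add_left)

lemma octo_cnj_ImO: "x \<in> ImO \<Longrightarrow> octo_cnj x = - x"
  by (simp add: ImO_def eq_neg_iff_add_eq_0 add.commute)

lemma inner_mult_ImO_left: "x \<in> ImO \<Longrightarrow> (x \<cdot>\<^sub>O y) \<bullet> z = - (y \<bullet> (x \<cdot>\<^sub>O z))"
  by (simp add: octo_mult_adjoint_left octo_cnj_ImO octo_mult_linear)

lemma inner_mult_ImO_right: "y \<in> ImO \<Longrightarrow> (x \<cdot>\<^sub>O y) \<bullet> z = - (x \<bullet> (z \<cdot>\<^sub>O y))"
  by (simp add: octo_mult_adjoint_right octo_cnj_ImO octo_mult_linear)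

lemma inner_mult_cancel_left: "(x \<cdot>\<^sub>O y) \<bullet> (x \<cdot>\<^sub>O z) = (x \<bullet> x) * (y \<bullet> z)"
  by (simp add: octo_mult_adjoint_left octo_cnj_mult_cancel_left)

lemma inner_mult_cancel_right: "(y \<cdot>\<^sub>O x) \<bullet> (z \<cdot>\<^sub>O x) = (x \<bullet> x) * (y \<bullet> z)"
  by (simp add: octo_mult_adjoint_right octo_cnj_mult_cancel_right)

lemma norm_octo_mult: "norm (x \<cdot>\<^sub>O y) = norm x * norm y"
  by (simp add: norm_eq_sqrt_inner inner_mult_cancel_left real_sqrt_mult)

lemma ImO_mult_self_left: "x \<in> ImO \<Longrightarrow> x \<cdot>\<^sub>O (x \<cdot>\<^sub>O y) = - ((x \<bullet> x) *\<^sub>R y)"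
  using octo_cnj_mult_cancel_left[of x y] by (simp add: octo_cnj_ImO octo_mult_linear
      neg_eq_iff_add_eq_0 eq_neg_iff_add_eq_0)

lemma ImO_mult_self_right: "x \<in> ImO \<Longrightarrow> (y \<cdot>\<^sub>O x) \<cdot>\<^sub>O x = - ((x \<bullet> x) *\<^sub>R y)"
  using octo_cnj_mult_cancel_right[of y x] by (simp add: octo_cnj_ImO octo_mult_linear
      neg_eq_iff_add_eq_0 eq_neg_iff_add_eq_0)

lemma ImO_mult_self: "x \<in> ImO \<Longrightarrow> x \<cdot>\<^sub>O x = - ((x \<bullet> x) *\<^sub>R octo_one)"
  using ImO_mult_self_left[of x octo_one] by simp

context
  fixes x y :: octo
  assumes xy: "x \<in> ImO" "y \<in> ImO" "x \<bullet> y = 0"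
begin

lemma ImO_sum: "x + y \<in> ImO" "(x + y) \<bullet> (x + y) = x \<bullet> x + y \<bullet> y"
  using xy by (simp_all add: subspace_add[OF subspace_ImO] inner_add_left inner_add_right inner_commute)

text \<open>Polarization: in \<open>ImO_mult_self_left\<close> at \<open>x + y\<close>, the
  instances at x and at y cancel, and since x and y are orthogonal the mixed terms must sum to
  zero.\<close>

lemma ImO_left_anticomm: "x \<cdot>\<^sub>O (y \<cdot>\<^sub>O z) = - (y \<cdot>\<^sub>O (x \<cdot>\<^sub>O z))"
  using ImO_mult_self_left[OF ImO_sum(1), of z] ImO_mult_self_left[OF xy(1), of z]
    ImO_mult_self_left[OF xy(2), of z]
    xy(3)
  by (simp add: octo_mult_linear eq_neg_iff_add_eq_0 inner_commute algebra_simps)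

lemma ImO_right_anticomm: "(z \<cdot>\<^sub>O x) \<cdot>\<^sub>O y = - ((z \<cdot>\<^sub>O y) \<cdot>\<^sub>O x)"
  using ImO_mult_self_right[OF ImO_sum(1), of z] ImO_mult_self_right[OF xy(1), of z]
    ImO_mult_self_right[OF xy(2), of z]
    xy(3)
  by (simp add: octo_mult_linear eq_neg_iff_add_eq_0 inner_commute algebra_simps)

lemma ImO_anticomm: "x \<cdot>\<^sub>O y = - (y \<cdot>\<^sub>O x)"
  using ImO_left_anticomm[of octo_one] by simp

lemma ImO_mult_ImO: "x \<cdot>\<^sub>O y \<in> ImO"
  using xy by (simp add: ImO_iff inner_mult_ImO_left[OF xy(1)]) (simp add: inner_commute)

end

section \<open>Angle between a vector and a subspace\<close>

text \<open>For a subspace W, \<open>proj\<close> says that v projects to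
  \<open>(v \<bullet> w) *\<^sub>R w\<close>. Cauchy-Schwarz then bounds the cosine of every angle
  with W, and arccos is decreasing, so the minimum is attained at w or at -w.\<close>

lemma subspace_angle_attained:
  assumes "v \<noteq> 0" "w \<in> W" "- w \<in> W" "norm w = 1"
    and proj: "\<And>y. y \<in> W \<Longrightarrow> v \<bullet> y = (y \<bullet> w) * (v \<bullet> w)"
  shows "subspace_angle v W = arccos (\<bar>v \<bullet> w\<bar> / norm v)"
proof -
  \<comment> \<open>The sign makes the inner product with v nonnegative.\<close>
  define u where "u = (if v \<bullet> w \<ge> 0 then w else - w)"
  have u: "u \<in> W - {0}" "vec_angle v u = arccos (\<bar>v \<bullet> w\<bar> / norm v)"
    using assms(1-4) by (auto simp: u_def vec_angle_def)
  have "arccos (\<bar>v \<bullet> w\<bar> / norm v) \<le> vec_angle v y" if y: "y \<in> W - {0}" for y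
  proof -
    have "v \<bullet> y \<le> \<bar>v \<bullet> y\<bar>"
      by simp
    also have "\<dots> = \<bar>y \<bullet> w\<bar> * \<bar>v \<bullet> w\<bar>"
      using y by (subst proj) (auto simp: abs_mult)
    also have "\<dots> \<le> norm y * \<bar>v \<bullet> w\<bar>"
      using Cauchy_Schwarz_ineq2[of y w] assms(4) by (intro mult_right_mono) auto
    finally have "v \<bullet> y \<le> norm y * \<bar>v \<bullet> w\<bar>" .
    then have "v \<bullet> y / norm y \<le> \<bar>v \<bullet> w\<bar>"
      using y by (simp add: divide_le_eq mult.commute)
    then have 1: "v \<bullet> y / (norm v * norm y) \<le> \<bar>v \<bullet> w\<bar> / norm v"
      using divide_right_mono[OF _ norm_ge_zero[of v], of "v \<bullet> y / norm y"] by (simp add: mult.commute)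
    have 2: "\<bar>v \<bullet> w\<bar> / norm v \<le> 1"
      using Cauchy_Schwarz_ineq2[of v w] assms(1,4) by simp
    have "\<bar>v \<bullet> y / (norm v * norm y)\<bar> \<le> 1"
      using Cauchy_Schwarz_ineq2[of v y] y assms(1) by (simp add: abs_mult divide_le_eq)
    then have 3: "- 1 \<le> v \<bullet> y / (norm v * norm y)"
      by linarith
    show ?thesis
      unfolding vec_angle_def by (intro arccos_le_arccos 1 2 3)
  qed
  moreover have "arccos (\<bar>v \<bullet> w\<bar> / norm v) \<in> vec_angle v ` (W - {0})"
    using u by (metis imageI)
  ultimately show ?thesis
    unfolding subspace_angle_def by (intro cInf_eq_minimum) blast+
qed

section \<open>Tangent spaces of round spheres\<close>

lemma has_derivative_eventually_const_eq_0:
  assumes "(f has_derivative f') (at x)" "\<forall>\<^sub>F t in nhds x. f t = c"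
  shows "f' t = 0"
proof -
  have "((\<lambda>t. c) has_derivative f') (at x)"
    using assms eventually_nhds_x_imp_x[OF assms(2)]
    by (intro has_derivative_transform_eventually[OF assms(1)]) (auto simp: eventually_at_filter elim: eventually_mono)
  then have "f' = (\<lambda>t. 0)"
    using has_derivative_const by (rule has_derivative_unique)
  then show ?thesis by simp
qed

text \<open>If z is the part of v orthogonal to S, the function
  \<open>(f t - f x) \<bullet> z\<close> vanishes near x, so its derivative, which equals
  \<open>z \<bullet> z\<close>, is zero.\<close>

lemma has_vector_derivative_in_subspace:
  fixes S :: "'a::euclidean_space set"
  assumes "subspace S" "\<forall>\<^sub>F t in nhds x. f t - f x \<in> S" "(f has_vector_derivative v) (at x)"
  shows "v \<in> S"
proof -
  obtain y z where y: "y \<in> span S" and z: "\<And>w. w \<in> span S \<Longrightarrow> orthogonal z w" and v: "v = y + z"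
    using orthogonal_subspace_decomp_exists[of S v] by blast
  have "((\<lambda>t. (f t - f x) \<bullet> z) has_derivative (\<lambda>t. (t *\<^sub>R v) \<bullet> z)) (at x)"
    using assms(3) unfolding has_vector_derivative_def
    by (auto intro!: derivative_eq_intros)
  moreover have "\<forall>\<^sub>F t in nhds x. (f t - f x) \<bullet> z = 0"
    using assms(2) by eventually_elim (metis z span_base orthogonal_def inner_commute)
  ultimately have "(1 *\<^sub>R v) \<bullet> z = 0"
    by (rule has_derivative_eventually_const_eq_0)
  then have "z \<bullet> z = 0"
    using z[OF y] by (simp add: v inner_add_left orthogonal_def inner_commute[of y])
  then show ?thesis
    using y v assms(1) by (simp add: span_eq_iff[THEN iffD2])
qed

text \<open>A curve in the sphere stays in the affine plane, so its velocity lies in P; its squared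
  distance to C is constant, so the velocity is orthogonal to u. Conversely, great circle arcs
  realize all such velocities.\<close>

lemma tangent_space_round_sphere:
  fixes P' :: "'a::euclidean_space set"
  assumes P: "subspace P" "P' = (\<lambda>x. C + x) ` P" and "0 < r" and u: "u \<in> P" "norm u = r"
  shows "tangent_space (P' \<inter> sphere C r) (C + u) = {v \<in> P. v \<bullet> u = 0}"
proof (intro set_eqI iffI)
  fix v assume "v \<in> tangent_space (P' \<inter> sphere C r) (C + u)"
  then obtain \<gamma> :: "real \<Rightarrow> 'a" where g: "\<gamma> 0 = C + u" "\<forall>\<^sub>F t in nhds 0. \<gamma> t \<in> P' \<inter> sphere C r"
    "(\<gamma> has_vector_derivative v) (at 0)" by (auto simp: tangent_space_def)
  have "\<forall>\<^sub>F t in nhds 0. \<gamma> t - \<gamma> 0 \<in> P"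
    using g(2)
  proof eventually_elim
    case (elim t)
    then obtain y where "y \<in> P" "\<gamma> t = C + y" using P by auto
    then show ?case using g(1) subspace_diff[OF P(1) _ u(1)] by simp
  qed
  then have "v \<in> P" by (intro has_vector_derivative_in_subspace[OF P(1) _ g(3)])
  moreover have "((\<lambda>t. (\<gamma> t - C) \<bullet> (\<gamma> t - C)) has_derivative (\<lambda>t. 2 * t * (v \<bullet> u))) (at 0)"
    using g(3) unfolding has_vector_derivative_def
    by (auto intro!: derivative_eq_intros simp: g(1) fun_eq_iff inner_commute)
  then have "2 * 1 * (v \<bullet> u) = 0"
  proof (rule has_derivative_eventually_const_eq_0)
    show "\<forall>\<^sub>F t in nhds 0. (\<gamma> t - C) \<bullet> (\<gamma> t - C) = r\<^sup>2"
      using g(2) by eventually_elim (auto simp: dist_norm norm_minus_commute simp flip: power2_norm_eq_inner)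
  qed
  ultimately show "v \<in> {v \<in> P. v \<bullet> u = 0}"
    by simp
next
  fix v assume v: "v \<in> {v \<in> P. v \<bullet> u = 0}"
  \<comment> \<open>The angular speed of uniform motion along the great circle through
    \<open>C + u\<close> with initial velocity v. For v = 0 it vanishes, and a constant curve is
    used instead.\<close>
  define k where "k = norm v / r"
  define \<gamma> where "\<gamma> t = C + (cos (k * t) *\<^sub>R u + (sin (k * t) / k) *\<^sub>R v)" for t
  have uu: "u \<bullet> u = r\<^sup>2" using u by (simp flip: power2_norm_eq_inner)
  show "v \<in> tangent_space (P' \<inter> sphere C r) (C + u)"
  proof (cases "v = 0")
    case True
    then show ?thesis using u P
      by (auto simp: tangent_space_def dist_norm intro!: exI[of _ "\<lambda>t. C + u"] derivative_eq_intros)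
  next
    case False
    then have k: "k > 0" "v \<bullet> v = k\<^sup>2 * r\<^sup>2"
      using \<open>0 < r\<close> by (simp_all add: k_def dot_square_norm field_simps)
    have "(cos (k * t) *\<^sub>R u + (sin (k * t) / k) *\<^sub>R v) \<bullet> (cos (k * t) *\<^sub>R u + (sin (k * t) / k) *\<^sub>R v)
        = (cos (k * t))\<^sup>2 * r\<^sup>2 + (sin (k * t))\<^sup>2 * r\<^sup>2" for t
      using v k(1) by (simp add: inner_add_left inner_add_right inner_commute uu k(2) power2_eq_square)
    also have "\<dots> t = r\<^sup>2" for t
      by (simp flip: distrib_right)
    finally have "norm (\<gamma> t - C) = r" for t
      using \<open>0 < r\<close> by (simp add: \<gamma>_def norm_eq_sqrt_inner)
    moreover have "\<gamma> t \<in> P'" for t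
      using v u P by (auto simp: \<gamma>_def subspace_add subspace_mul)
    ultimately have "\<gamma> t \<in> P' \<inter> sphere C r" for t
      by (simp add: dist_norm norm_minus_commute)
    moreover have "(\<gamma> has_vector_derivative v) (at 0)"
      unfolding \<gamma>_def has_vector_derivative_def using k
      by (auto intro!: derivative_eq_intros)
    ultimately show ?thesis
      by (auto simp: tangent_space_def \<gamma>_def intro!: exI[of _ \<gamma>])
  qed
qed

section \<open>Orthogonal systems and frames in dimension three\<close>

text \<open>For an explicit list, \<open>sorted_wrt\<close> unfolds to one inner product per pair.
  Distinctness comes for free, as a repeated vector would be orthogonal to itself.\<close>

lemma orthogonal_list_distinct_pairwise:
  assumes "sorted_wrt (\<lambda>x y. x \<bullet> y = 0) xs" "0 \<notin> set xs"
  shows "distinct xs \<and> pairwise orthogonal (set xs)"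
  using assms
  by (induction xs) (auto simp: pairwise_insert orthogonal_def inner_commute)

text \<open>A nonzero v would extend the list to more independent vectors than the dimension
  allows.\<close>

lemma orthogonal_to_orthogonal_list_eq_0:
  fixes xs :: "'a::euclidean_space list"
  assumes "sorted_wrt (\<lambda>x y. x \<bullet> y = 0) xs" "0 \<notin> set xs" "length xs = DIM('a)"
    and "\<forall>x\<in>set xs. v \<bullet> x = 0"
  shows "v = 0"
proof (rule ccontr)
  assume "v \<noteq> 0"
  then have "distinct (v # xs)" "pairwise orthogonal (set (v # xs))" "0 \<notin> set (v # xs)"
    using orthogonal_list_distinct_pairwise[of "v # xs"] assms by auto
  then show False
    using pairwise_orthogonal_independent independent_bound distinct_card assms(3)
    by (metis length_Cons not_less_eq_eq order_refl)
qed

text \<open>Here n, a and \<open>cross3 n a\<close> form an oriented orthonormal frame. If y is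
  orthogonal to n, then a and y both lie in the plane normal to n, so \<open>cross3 a y\<close> is a
  multiple of n. This provides the hypothesis \<open>proj\<close> of
  \<open>subspace_angle_attained\<close>.\<close>

lemma real3_unit_orthogonal_frame:
  fixes n a y :: "real^3"
  assumes "n \<bullet> n = 1" "a \<bullet> a = 1" "n \<bullet> a = 0"
  shows "cross3 a (cross3 n a) = n" "cross3 n a \<bullet> cross3 n a = 1"
    "y \<bullet> n = 0 \<Longrightarrow> cross3 a y = (y \<bullet> cross3 n a) *\<^sub>R cross3 a (cross3 n a)"
proof -
  show 1: "cross3 a (cross3 n a) = n"
    using assms by (simp add: Lagrange inner_commute)
  show "cross3 n a \<bullet> cross3 n a = 1"
    using assms by (simp add: dot_cross inner_commute)
  assume "y \<bullet> n = 0"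
  then have "cross3 n (cross3 a y) = 0"
    using assms by (simp add: Lagrange inner_commute)
  moreover have "cross3 n (cross3 n (cross3 a y)) = (n \<bullet> cross3 a y) *\<^sub>R n - cross3 a y"
    using assms(1) by (subst Lagrange) simp
  ultimately have "cross3 a y = (n \<bullet> cross3 a y) *\<^sub>R n"
    by simp
  also have "n \<bullet> cross3 a y = y \<bullet> cross3 n a"
    by (metis cross_triple inner_commute)
  finally show "cross3 a y = (y \<bullet> cross3 n a) *\<^sub>R cross3 a (cross3 n a)"
    by (simp add: 1)
qed

section \<open>Coordinates on the plane of an orthonormal imaginary triple\<close>

locale orthonormal_ImO_triple =
  fixes f1 f2 f3 :: octo
  assumes ImO: "f1 \<in> ImO" "f2 \<in> ImO" "f3 \<in> ImO"
    and unit: "f1 \<bullet> f1 = 1" "f2 \<bullet> f2 = 1" "f3 \<bullet> f3 = 1"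
    and orth: "f1 \<bullet> f2 = 0" "f1 \<bullet> f3 = 0" "f2 \<bullet> f3 = 0"
begin

text \<open>The sign depends on the orientation of the basis; the invariant of the plane is the
  absolute value.\<close>

abbreviation \<phi> :: real where "\<phi> \<equiv> assoc_form f1 f2 f3"

lemma orth': "f2 \<bullet> f1 = 0" "f3 \<bullet> f1 = 0" "f3 \<bullet> f2 = 0"
  using orth by (simp_all add: inner_commute)

lemma products_commute:
  "f3 \<cdot>\<^sub>O f2 = - (f2 \<cdot>\<^sub>O f3)" "f1 \<cdot>\<^sub>O f3 = - (f3 \<cdot>\<^sub>O f1)" "f2 \<cdot>\<^sub>O f1 = - (f1 \<cdot>\<^sub>O f2)"
  by (intro ImO_anticomm ImO orth orth')+

text \<open>Isometric coordinates, which make the cross product of \<open>real^3\<close> available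
  in the plane.\<close>

definition F :: "real^3 \<Rightarrow> octo" where
  "F a = a$1 *\<^sub>R f1 + a$2 *\<^sub>R f2 + a$3 *\<^sub>R f3"

text \<open>
  Pairing this vector with the cross product gives the restriction of \<open>assoc_form C\<close> to the
  plane, see \<open>inner_mult_F\<close>.
\<close>

definition form_vector :: "octo \<Rightarrow> real^3" where
  "form_vector C = vector [C \<bullet> (f2 \<cdot>\<^sub>O f3), C \<bullet> (f3 \<cdot>\<^sub>O f1), C \<bullet> (f1 \<cdot>\<^sub>O f2)]"

lemma inner_F: "F a \<bullet> F b = a \<bullet> b"
  by (simp add: F_def inner_add_left inner_add_right unit orth orth' inner_vec_def sum_3)

lemma norm_F: "norm (F a) = norm a"
  by (simp add: norm_eq_sqrt_inner inner_F)

lemma linear_F: "linear F"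
  by (auto simp: linear_iff F_def algebra_simps)

lemma range_F: "range F = span {f1, f2, f3}"
proof (intro equalityI subsetI)
  fix x assume "x \<in> range F"
  then obtain a where "x = F a" by blast
  then show "x \<in> span {f1, f2, f3}"
    unfolding F_def by (simp add: span_add span_scale span_base)
next
  fix x assume "x \<in> span {f1, f2, f3}"
  moreover have "span {f1, f2, f3} \<subseteq> range F"
  proof (rule span_minimal)
    have "F (axis 1 1) = f1" "F (axis 2 1) = f2" "F (axis 3 1) = f3"
      by (simp_all add: F_def axis_def)
    then show "{f1, f2, f3} \<subseteq> range F" by (metis empty_subsetI insert_subset rangeI)
    show "subspace (range F)"
      using linear_F by (simp add: linear_subspace_image)
  qed
  ultimately show "x \<in> range F" by blast
qed

lemma F_ImO: "F a \<in> ImO"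
  using ImO by (simp add: F_def subspace_add subspace_mul subspace_ImO)

text \<open>For imaginary C the form \<open>(C \<cdot>\<^sub>O x) \<bullet> y\<close> is alternating
  in imaginary x and y, so on the plane it factors through the cross product of the
  coordinates.\<close>

lemma inner_mult_F:
  assumes "C \<in> ImO"
  shows "(C \<cdot>\<^sub>O F a) \<bullet> F b = form_vector C \<bullet> cross3 a b"
proof -
  have self: "(C \<cdot>\<^sub>O x) \<bullet> x = 0" if "x \<in> ImO" for x
    using assms that by (simp add: inner_mult_ImO_right ImO_mult_self ImO_iff)
  have "(C \<cdot>\<^sub>O f1) \<bullet> f2 = C \<bullet> (f1 \<cdot>\<^sub>O f2)" "(C \<cdot>\<^sub>O f2) \<bullet> f3 = C \<bullet> (f2 \<cdot>\<^sub>O f3)" "(C \<cdot>\<^sub>O f3) \<bullet> f1 = C \<bullet> (f3 \<cdot>\<^sub>O f1)"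
     "(C \<cdot>\<^sub>O f2) \<bullet> f1 = - (C \<bullet> (f1 \<cdot>\<^sub>O f2))" "(C \<cdot>\<^sub>O f3) \<bullet> f2 = - (C \<bullet> (f2 \<cdot>\<^sub>O f3))" "(C \<cdot>\<^sub>O f1) \<bullet> f3 = - (C \<bullet> (f3 \<cdot>\<^sub>O f1))"
    by (simp_all add: inner_mult_ImO_right ImO products_commute)
  then show ?thesis
    by (simp add: F_def octo_mult_linear self ImO form_vector_def
        inner_vec_def sum_3 cross_components algebra_simps)
qed

text \<open>The associative form is invariant under cyclic shifts and vanishes on repeated
  arguments. Consequently the radial part of a point of the sphere contributes a constant to the
  cosine of the angle.\<close>

lemma form_vector_F: "form_vector (F n) = \<phi> *\<^sub>R n"
proof -
  have "f2 \<bullet> (f3 \<cdot>\<^sub>O f1) = \<phi>" "f3 \<bullet> (f1 \<cdot>\<^sub>O f2) = \<phi>"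
    using inner_mult_ImO_left[OF ImO(2), of f3 f1] inner_mult_ImO_right[OF ImO(3), of f2 f1]
    by (simp_all add: assoc_form_def products_commute inner_commute)
  moreover have "x \<bullet> (x \<cdot>\<^sub>O y) = 0" "y \<bullet> (x \<cdot>\<^sub>O y) = 0" if "x \<in> ImO" "y \<in> ImO" for x y
    using inner_mult_ImO_left[OF that(1), of x y] inner_mult_ImO_right[OF that(2), of y x] that
       inner_mult_ImO_left[OF that(1), of y x] inner_mult_ImO_right[OF that(2), of x y]
    by (simp_all add: ImO_mult_self ImO_iff inner_commute)
  ultimately show ?thesis
    by (simp add: form_vector_def F_def inner_add_left ImO vec_eq_iff forall_3 assoc_form_def)
qed

lemma linear_form_vector: "linear form_vector"
  by (simp add: linear_iff form_vector_def vec_eq_iff forall_3 inner_add_left)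

section \<open>Wirtinger angles of round spheres\<close>

lemma wirtinger_angle_round_sphere:
  assumes C: "C \<in> ImO" "0 < r" and n: "norm n = 1" and p: "norm (C + r *\<^sub>R F n) = 1"
    and N: "N = (\<lambda>x. C + x) ` range F \<inter> sphere C r"
    and X: "X \<in> tangent_space N (C + r *\<^sub>R F n) - {0}"
  shows "wirtinger_angle N (C + r *\<^sub>R F n) X =
    arccos \<bar>form_vector C \<bullet> n + r * \<phi>\<bar>"
    and "\<bar>form_vector C \<bullet> n + r * \<phi>\<bar> \<le> 1"
proof -
  define p where "p = C + r *\<^sub>R F n"
  have Fr: "r *\<^sub>R F n = F (r *\<^sub>R n)"
    using linear_F by (simp add: linear_scale)
  have T: "tangent_space N p = {v \<in> range F. v \<bullet> (r *\<^sub>R F n) = 0}"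
    unfolding N p_def Fr using C(2) n linear_F
    by (intro tangent_space_round_sphere) (simp_all add: linear_subspace_image norm_F)
  have TF: "F x \<in> tangent_space N p \<longleftrightarrow> x \<bullet> n = 0" for x
    using C(2) by (auto simp: T inner_F)
  obtain x where x: "X = F x"
    using X T p_def by auto
  have xn: "x \<bullet> n = 0" "x \<noteq> 0"
    using X TF p_def linear_0[OF linear_F] by (auto simp: x)
  define a where "a = x /\<^sub>R norm x"
  have a: "x = norm x *\<^sub>R a" "a \<bullet> a = 1" "n \<bullet> a = 0"
    using xn by (simp_all add: a_def inner_commute dot_square_norm power2_eq_square)
  have nn: "n \<bullet> n = 1" using n by (simp add: norm_eq_sqrt_inner)
  note fr = real3_unit_orthogonal_frame[OF nn a(2,3)]
  define w where "w = F (cross3 n a)"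
  have w: "norm w = 1"
    using fr(2) by (simp add: w_def norm_eq_1 inner_F)
  have pI: "p \<in> ImO"
    unfolding p_def by (intro subspace_add subspace_mul subspace_ImO C F_ImO)
  \<comment> \<open>The center and the radial part contribute separately. Pairing with
    \<open>cross3 a (cross3 n a)\<close>, which is n, then gives the affine function of n.\<close>
  have np: "form_vector p = form_vector C + (r * \<phi>) *\<^sub>R n"
    using linear_form_vector by (simp add: p_def linear_add linear_scale form_vector_F)
  have v: "J p X \<bullet> F y = norm x * (form_vector p \<bullet> cross3 a y)" for y
    unfolding J_def x inner_mult_F[OF pI] by (subst a(1)) (simp add: cross_mult_left)
  have nv: "norm (J p X) = norm x"
    using p by (simp add: J_def norm_octo_mult x norm_F p_def)
  have vw: "J p X \<bullet> w = norm x * (form_vector C \<bullet> n + r * \<phi>)"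
    unfolding w_def v fr(1) np by (simp add: inner_add_left nn)
  have "wirtinger_angle N p X = arccos (\<bar>J p X \<bullet> w\<bar> / norm (J p X))"
    unfolding wirtinger_angle_def
  proof (rule subspace_angle_attained)
    show "J p X \<noteq> 0" using nv xn by (metis norm_eq_zero)
    have "- w = F (- cross3 n a)" using linear_F by (simp add: w_def linear_neg)
    then show "w \<in> tangent_space N p" "- w \<in> tangent_space N p"
      by (simp_all add: w_def TF dot_cross_self inner_commute)
    show "norm w = 1" by (fact w)
    fix y assume "y \<in> tangent_space N p"
    then obtain z where z: "y = F z" "z \<bullet> n = 0"
      using T TF by auto
    show "J p X \<bullet> y = (y \<bullet> w) * (J p X \<bullet> w)"
      unfolding z(1) w_def v inner_F by (simp add: fr(3)[OF z(2)])
  qed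
  also have "\<bar>J p X \<bullet> w\<bar> / norm (J p X) = \<bar>form_vector C \<bullet> n + r * \<phi>\<bar>"
    using xn by (simp add: vw nv abs_mult)
  finally show "wirtinger_angle N (C + r *\<^sub>R F n) X = arccos \<bar>form_vector C \<bullet> n + r * \<phi>\<bar>"
    by (simp add: p_def)
  \<comment> \<open>Cauchy-Schwarz for the unit vector w. The bound keeps the values in the range
    where arccos is injective.\<close>
  show "\<bar>form_vector C \<bullet> n + r * \<phi>\<bar> \<le> 1"
    using Cauchy_Schwarz_ineq2[of "J p X" w] xn by (simp add: vw nv abs_mult w)
qed

section \<open>Products of the basis vectors and the associator\<close>

lemma products_ImO: "f2 \<cdot>\<^sub>O f3 \<in> ImO" "f3 \<cdot>\<^sub>O f1 \<in> ImO" "f1 \<cdot>\<^sub>O f2 \<in> ImO"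
  by (intro ImO_mult_ImO ImO orth orth')+

lemma inner_products:
  "(f2 \<cdot>\<^sub>O f3) \<bullet> f1 = \<phi>" "(f3 \<cdot>\<^sub>O f1) \<bullet> f2 = \<phi>" "(f1 \<cdot>\<^sub>O f2) \<bullet> f3 = \<phi>"
  using form_vector_F[of "axis 1 1"] form_vector_F[of "axis 2 1"] form_vector_F[of "axis 3 1"]
  by (simp_all add: F_def form_vector_def axis_def vec_eq_iff forall_3 inner_commute)

text \<open>With a factor read as its product with \<open>octo_one\<close>, cancellation reduces
  each claim to the orthogonality of an imaginary element to 1.\<close>

lemma inner_products_0:
  "(f2 \<cdot>\<^sub>O f3) \<bullet> f2 = 0" "(f2 \<cdot>\<^sub>O f3) \<bullet> f3 = 0" "(f3 \<cdot>\<^sub>O f1) \<bullet> f3 = 0" "(f3 \<cdot>\<^sub>O f1) \<bullet> f1 = 0"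
  "(f1 \<cdot>\<^sub>O f2) \<bullet> f1 = 0" "(f1 \<cdot>\<^sub>O f2) \<bullet> f2 = 0"
  using inner_mult_cancel_left[of f2 f3 octo_one] inner_mult_cancel_right[of f2 f3 octo_one]
    inner_mult_cancel_left[of f3 f1 octo_one] inner_mult_cancel_right[of f3 f1 octo_one]
    inner_mult_cancel_left[of f1 f2 octo_one] inner_mult_cancel_right[of f1 f2 octo_one] ImO
  by (simp_all add: ImO_iff)

text \<open>Two different products share a factor; anticommutation brings it to the left in both,
  where it cancels.\<close>

lemma inner_products_products:
  "(f2 \<cdot>\<^sub>O f3) \<bullet> (f2 \<cdot>\<^sub>O f3) = 1" "(f3 \<cdot>\<^sub>O f1) \<bullet> (f3 \<cdot>\<^sub>O f1) = 1" "(f1 \<cdot>\<^sub>O f2) \<bullet> (f1 \<cdot>\<^sub>O f2) = 1"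
  "(f2 \<cdot>\<^sub>O f3) \<bullet> (f3 \<cdot>\<^sub>O f1) = 0" "(f2 \<cdot>\<^sub>O f3) \<bullet> (f1 \<cdot>\<^sub>O f2) = 0" "(f3 \<cdot>\<^sub>O f1) \<bullet> (f1 \<cdot>\<^sub>O f2) = 0"
  using inner_mult_cancel_left[of f3 f2 f1] inner_mult_cancel_left[of f2 f3 f1] inner_mult_cancel_left[of f1 f3 f2]
  by (simp_all add: inner_mult_cancel_left products_commute unit orth orth')

text \<open>
  The part \<open>w\<close> of \<open>f3\<close> orthogonal to the quaternion subalgebra generated by \<open>f1\<close> and \<open>f2\<close>
  satisfies \<open>f1 (f2 w) = - (f1 f2) w\<close>, so the associator is \<open>2 (f1 f2) w\<close>.
\<close>

lemma norm_associator: "(norm (associator f1 f2 f3))\<^sup>2 = 4 * (1 - \<phi>\<^sup>2)"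
proof -
  define w where "w = f3 - \<phi> *\<^sub>R (f1 \<cdot>\<^sub>O f2)"
  have w: "w \<in> ImO" "f1 \<bullet> w = 0" "f2 \<bullet> w = 0" "w \<bullet> (f1 \<cdot>\<^sub>O f2) = 0" "w \<bullet> w = 1 - \<phi>\<^sup>2"
    unfolding w_def
    using inner_products(3)[THEN trans[OF inner_commute]] inner_products_0(5,6)[THEN trans[OF inner_commute]]
    by (simp_all add: subspace_diff subspace_mul subspace_ImO ImO products_ImO inner_diff_left inner_diff_right
        orth orth' inner_products inner_products_0 inner_products_products unit power2_eq_square)
  \<comment> \<open>That w is orthogonal to f1 f2 makes f1 w orthogonal to f2, so these two
    anticommute.\<close>
  have fw: "f1 \<cdot>\<^sub>O w \<in> ImO" "(f1 \<cdot>\<^sub>O w) \<bullet> f2 = 0"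
    using w by (simp_all add: ImO_mult_ImO ImO inner_mult_ImO_left)
  have "(f1 \<cdot>\<^sub>O f2) \<cdot>\<^sub>O w = - ((f1 \<cdot>\<^sub>O w) \<cdot>\<^sub>O f2)"
    by (intro ImO_right_anticomm ImO w)
  also have "\<dots> = f2 \<cdot>\<^sub>O (f1 \<cdot>\<^sub>O w)"
    using ImO_anticomm[OF fw(1) ImO(2) fw(2)] by simp
  also have "\<dots> = - (f1 \<cdot>\<^sub>O (f2 \<cdot>\<^sub>O w))"
    by (intro ImO_left_anticomm ImO orth orth')
  finally have 1: "f1 \<cdot>\<^sub>O (f2 \<cdot>\<^sub>O w) = - ((f1 \<cdot>\<^sub>O f2) \<cdot>\<^sub>O w)"
    by simp
  \<comment> \<open>The component of f3 along f1 f2 drops out of the associator, since both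
    bracketings give -1 on f1 f2.\<close>
  have 2: "f1 \<cdot>\<^sub>O (f2 \<cdot>\<^sub>O (f1 \<cdot>\<^sub>O f2)) = - octo_one"
    using products_commute(3) ImO_mult_self_left[OF ImO(2), of f1] ImO_mult_self[OF ImO(1)]
    by (simp add: unit octo_mult_linear minus_equation_iff[of "_ \<cdot>\<^sub>O _"])
  have f3: "f3 = \<phi> *\<^sub>R (f1 \<cdot>\<^sub>O f2) + w"
    by (simp add: w_def)
  have "associator f1 f2 (\<phi> *\<^sub>R (f1 \<cdot>\<^sub>O f2) + w) = 2 *\<^sub>R ((f1 \<cdot>\<^sub>O f2) \<cdot>\<^sub>O w)"
    unfolding associator_def octo_mult_linear 1 2
    by (simp add: ImO_mult_self products_ImO inner_products_products scaleR_2)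
  then have "associator f1 f2 f3 = 2 *\<^sub>R ((f1 \<cdot>\<^sub>O f2) \<cdot>\<^sub>O w)"
    by (simp flip: f3)
  then show ?thesis
    using w(5) inner_products_products(3)
    by (simp add: power2_norm_eq_inner inner_mult_cancel_left)
qed

text \<open>Moving the outer factor f3 or f1 across the inner product leaves known inner products.
  Both bracketings contribute 0, except against \<open>octo_one\<close>, where both contribute
  \<open>- \<phi>\<close>.\<close>

lemma inner_associator:
  "associator f1 f2 f3 \<bullet> f1 = 0" "associator f1 f2 f3 \<bullet> f2 = 0" "associator f1 f2 f3 \<bullet> f3 = 0"
  "associator f1 f2 f3 \<bullet> octo_one = 0"
  "associator f1 f2 f3 \<bullet> (f2 \<cdot>\<^sub>O f3) = 0" "associator f1 f2 f3 \<bullet> (f3 \<cdot>\<^sub>O f1) = 0" "associator f1 f2 f3 \<bullet> (f1 \<cdot>\<^sub>O f2) = 0"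
proof -
  have one: "f1 \<bullet> octo_one = 0" "f2 \<bullet> octo_one = 0" "f3 \<bullet> octo_one = 0"
    "(f2 \<cdot>\<^sub>O f3) \<bullet> octo_one = 0" "(f3 \<cdot>\<^sub>O f1) \<bullet> octo_one = 0" "(f1 \<cdot>\<^sub>O f2) \<bullet> octo_one = 0"
    using ImO products_ImO by (simp_all add: ImO_iff)
  have R: "((f1 \<cdot>\<^sub>O f2) \<cdot>\<^sub>O f3) \<bullet> y = - ((f1 \<cdot>\<^sub>O f2) \<bullet> (y \<cdot>\<^sub>O f3))"
    and L: "(f1 \<cdot>\<^sub>O (f2 \<cdot>\<^sub>O f3)) \<bullet> y = - ((f2 \<cdot>\<^sub>O f3) \<bullet> (f1 \<cdot>\<^sub>O y))" for y
    by (simp_all add: inner_mult_ImO_left inner_mult_ImO_right ImO)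
  have sq: "x \<cdot>\<^sub>O x = - octo_one" if "x \<in> ImO" "x \<bullet> x = 1" for x
    using that by (simp add: ImO_mult_self)
  have 1: "(f2 \<cdot>\<^sub>O f3) \<cdot>\<^sub>O f3 = - f2" "(f3 \<cdot>\<^sub>O f1) \<cdot>\<^sub>O f3 = f1"
     "f1 \<cdot>\<^sub>O (f3 \<cdot>\<^sub>O f1) = f3" "f1 \<cdot>\<^sub>O (f1 \<cdot>\<^sub>O f2) = - f2"
     "(f1 \<cdot>\<^sub>O f2) \<bullet> ((f1 \<cdot>\<^sub>O f2) \<cdot>\<^sub>O f3) = 0" "(f2 \<cdot>\<^sub>O f3) \<bullet> (f1 \<cdot>\<^sub>O (f2 \<cdot>\<^sub>O f3)) = 0"
    using ImO_mult_self_right[OF ImO(3), of f2] ImO_mult_self_right[OF ImO(3), of f1]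
      ImO_mult_self_left[OF ImO(1), of f3] ImO_mult_self_left[OF ImO(1), of f2]
      inner_mult_cancel_left[of "f1 \<cdot>\<^sub>O f2" octo_one f3] inner_mult_cancel_right[of octo_one "f2 \<cdot>\<^sub>O f3" f1] one
      products_commute
    by (simp_all add: unit octo_mult_linear inner_commute)
  have comm: "(f1 \<cdot>\<^sub>O f2) \<bullet> (f3 \<cdot>\<^sub>O f1) = 0" "(f1 \<cdot>\<^sub>O f2) \<bullet> (f2 \<cdot>\<^sub>O f3) = 0"
    using inner_products_products(5,6) by (simp_all add: inner_commute)
  show "associator f1 f2 f3 \<bullet> f1 = 0" "associator f1 f2 f3 \<bullet> f2 = 0" "associator f1 f2 f3 \<bullet> f3 = 0"
  "associator f1 f2 f3 \<bullet> octo_one = 0"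
  "associator f1 f2 f3 \<bullet> (f2 \<cdot>\<^sub>O f3) = 0" "associator f1 f2 f3 \<bullet> (f3 \<cdot>\<^sub>O f1) = 0" "associator f1 f2 f3 \<bullet> (f1 \<cdot>\<^sub>O f2) = 0"
    unfolding associator_def inner_diff_left R L
    by (simp_all add: 1 sq ImO unit products_commute one inner_products inner_products_0 inner_products_products
        comm)
qed

lemma form_vector_associator: "form_vector (k *\<^sub>R associator f1 f2 f3) = 0"
  by (simp add: form_vector_def vec_eq_iff forall_3 inner_associator)

lemma eq_multiple_of_associator:
  assumes "\<phi>\<^sup>2 \<noteq> 1" and C: "C \<in> ImO" "C \<bullet> f1 = 0" "C \<bullet> f2 = 0" "C \<bullet> f3 = 0" "form_vector C = 0"
  shows "\<exists>k. C = k *\<^sub>R associator f1 f2 f3"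
proof -
  define a where "a = associator f1 f2 f3"
  define g1 g2 g3 where g: "g1 = f2 \<cdot>\<^sub>O f3" "g2 = f3 \<cdot>\<^sub>O f1" "g3 = f1 \<cdot>\<^sub>O f2"
  have aa: "a \<bullet> a = 4 * (1 - \<phi>\<^sup>2)"
    unfolding a_def norm_associator[symmetric] by (rule power2_norm_eq_inner[symmetric])
  then have an: "a \<bullet> a \<noteq> 0" using assms(1) by simp
  \<comment> \<open>The component of C orthogonal to the associator, to be shown zero.\<close>
  define D where "D = C - ((C \<bullet> a) / (a \<bullet> a)) *\<^sub>R a"
  \<comment> \<open>An orthogonal basis of the octonions: subtracting \<open>\<phi>\<close> times
    the basis vector makes each product orthogonal to the plane. The corrected products have squared
    norm \<open>1 - \<phi>\<^sup>2\<close>, nonzero by assumption.\<close>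
  define xs where "xs = [octo_one, f1, f2, f3, g1 - \<phi> *\<^sub>R f1, g2 - \<phi> *\<^sub>R f2, g3 - \<phi> *\<^sub>R f3, a]"
  have one: "f1 \<bullet> octo_one = 0" "f2 \<bullet> octo_one = 0" "f3 \<bullet> octo_one = 0"
    "g1 \<bullet> octo_one = 0" "g2 \<bullet> octo_one = 0" "g3 \<bullet> octo_one = 0" "C \<bullet> octo_one = 0"
    using ImO products_ImO C(1) by (simp_all add: ImO_iff g)
  note ip = inner_products[folded g] inner_products_0[folded g] inner_products_products(4-6)[folded g]
    inner_associator[folded a_def, folded g] one orth
  note sq = inner_products_products(1-3)[folded g] unit
  have comm: "y \<bullet> x = c" if "x \<bullet> y = c" for x y :: octo and c using that by (simp add: inner_commute)
  have Cg: "C \<bullet> g1 = 0" "C \<bullet> g2 = 0" "C \<bullet> g3 = 0"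
    using C(5) by (simp_all add: form_vector_def g vec_eq_iff forall_3)
  have gn: "(g1 - \<phi> *\<^sub>R f1) \<bullet> (g1 - \<phi> *\<^sub>R f1) = 1 - \<phi>\<^sup>2"
    "(g2 - \<phi> *\<^sub>R f2) \<bullet> (g2 - \<phi> *\<^sub>R f2) = 1 - \<phi>\<^sup>2"
    "(g3 - \<phi> *\<^sub>R f3) \<bullet> (g3 - \<phi> *\<^sub>R f3) = 1 - \<phi>\<^sup>2"
    by (simp_all add: inner_diff_left inner_diff_right ip ip[THEN comm] sq power2_eq_square)
  have "D = 0"
  proof (rule orthogonal_to_orthogonal_list_eq_0)
    show "sorted_wrt (\<lambda>x y. x \<bullet> y = 0) xs"
      by (simp add: xs_def inner_diff_left inner_diff_right ip ip[THEN comm] sq)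
    have "\<forall>x\<in>set xs. x \<bullet> x \<noteq> 0"
      unfolding xs_def list.set ball_simps gn using assms(1) an unit by simp
    then show "0 \<notin> set xs" by force
    show "length xs = DIM(octo)"
      by (simp add: xs_def)
    show "\<forall>x\<in>set xs. D \<bullet> x = 0"
      using an by (simp add: xs_def D_def inner_diff_left inner_diff_right ip ip[THEN comm] sq C Cg)
  qed
  then have "C = ((C \<bullet> a) / (a \<bullet> a)) *\<^sub>R a" by (simp add: D_def)
  then show ?thesis unfolding a_def by (rule exI)
qed

section \<open>Associative planes\<close>

text \<open>This is the equality case of Cauchy-Schwarz: the unit vectors f2 f3 and f1 have inner
  product \<open>\<phi>\<close>, so f2 f3 is \<open>\<phi>\<close> times f1.\<close>

lemma associative_plane_if_\<phi>:
  assumes "\<phi>\<^sup>2 = 1"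
  shows "associative_plane (span {f1, f2, f3})"
proof -
  define g where "g = f2 \<cdot>\<^sub>O f3"
  have gI: "g \<in> ImO" "g \<bullet> g = 1"
    unfolding g_def by (rule products_ImO inner_products_products)+
  have "(g - \<phi> *\<^sub>R f1) \<bullet> (g - \<phi> *\<^sub>R f1) = 0"
    using assms inner_products(1)
    by (simp add: inner_diff_left inner_diff_right gI unit g_def[symmetric] inner_commute power2_eq_square)
  then have gf: "g = \<phi> *\<^sub>R f1"
    by simp
  then have fg: "f1 = \<phi> *\<^sub>R g"
    using assms by (simp add: power2_eq_square)
  have m: "f2 \<cdot>\<^sub>O f2 = - octo_one" "f3 \<cdot>\<^sub>O f3 = - octo_one" "g \<cdot>\<^sub>O g = - octo_one"
    "f2 \<cdot>\<^sub>O f3 = g" "f3 \<cdot>\<^sub>O f2 = - g" "f2 \<cdot>\<^sub>O g = - f3" "g \<cdot>\<^sub>O f3 = - f2"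
    using products_commute(1) ImO_mult_self_left[OF ImO(2), of f3] ImO_mult_self_right[OF ImO(3), of f2]
    by (simp_all add: ImO_mult_self ImO gI unit flip: g_def)
  have gf23: "g \<bullet> f2 = 0" "g \<bullet> f3 = 0"
    using inner_products_0 by (simp_all add: g_def)
  have m': "g \<cdot>\<^sub>O f2 = f3" "f3 \<cdot>\<^sub>O g = f2"
    using ImO_anticomm[OF gI(1) ImO(2) gf23(1)] ImO_anticomm[OF gI(1) ImO(3) gf23(2)] m by simp_all
  have one: "f2 \<bullet> octo_one = 0" "f3 \<bullet> octo_one = 0" "g \<bullet> octo_one = 0"
    using ImO gI by (simp_all add: ImO_iff)
  \<comment> \<open>The images of 1, i, j, k are 1, f2, f3 and g = f2 f3; a pair (a, b) stands for a
    + b j, so the imaginary part of b is the coefficient of k.\<close>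
  define h :: "quat \<Rightarrow> octo" where
    "h q = Re (fst q) *\<^sub>R octo_one + Im (fst q) *\<^sub>R f2 + Re (snd q) *\<^sub>R f3 + Im (snd q) *\<^sub>R g" for q
  have lin: "linear h"
    by (auto simp: linear_iff h_def algebra_simps)
  have hi: "h q \<bullet> octo_one = Re (fst q)" "h q \<bullet> f2 = Im (fst q)" "h q \<bullet> f3 = Re (snd q)" "h q \<bullet> g = Im (snd q)" for q
    using one one[THEN trans[OF inner_commute]] gf23 gf23[THEN trans[OF inner_commute]] orth orth'
    by (simp_all add: h_def inner_add_left unit gI)
  have "inj h"
    unfolding linear_injective_0[OF lin]
  proof (intro allI impI)
    fix q assume "h q = 0"
    then have "Re (fst q) = 0" "Im (fst q) = 0" "Re (snd q) = 0" "Im (snd q) = 0"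
      using hi[of q] by simp_all
    then show "q = 0" by (simp add: prod_eq_iff complex_eq_iff)
  qed
  moreover have "h (q \<cdot>\<^sub>H s) = h q \<cdot>\<^sub>O h s" for q s
    by (simp add: h_def quat_mult_def octo_mult_linear m m' algebra_simps)
  moreover have "h quat_one = octo_one"
    by (simp add: h_def quat_one_def)
  moreover have "span {f1, f2, f3} = range h \<inter> ImO"
  proof (intro equalityI subsetI)
    fix x assume "x \<in> span {f1, f2, f3}"
    then obtain a where a: "x = F a" by (auto simp flip: range_F)
    have "F a = h (Complex 0 (a$2), Complex (a$3) (\<phi> * a$1))"
      by (subst F_def, subst fg) (simp add: h_def)
    then show "x \<in> range h \<inter> ImO" by (metis IntI a F_ImO rangeI)
  next
    fix x assume "x \<in> range h \<inter> ImO"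
    then obtain q where q: "x = h q" "Re (fst q) = 0" using hi by (auto simp: ImO_iff)
    then have "x = F (vector [Im (snd q) * \<phi>, Im (fst q), Re (snd q)])"
      by (simp add: h_def F_def gf)
    then show "x \<in> span {f1, f2, f3}" using range_F by blast
  qed
  ultimately show ?thesis
    unfolding associative_plane_def quaternionic_subalgebra_def using lin by blast
qed

text \<open>Products of basis vectors are imaginary and stay in the subalgebra, so they lie in the
  plane. Thus f2 f3 is a unit vector whose only coordinate is \<open>\<phi>\<close> along f1, and a
  C orthogonal to the plane is orthogonal to all three products.\<close>

lemma associative_planeD:
  assumes "associative_plane (span {f1, f2, f3})"
  shows "\<phi>\<^sup>2 = 1" "\<lbrakk>C \<bullet> f1 = 0; C \<bullet> f2 = 0; C \<bullet> f3 = 0\<rbrakk> \<Longrightarrow> form_vector C = 0"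
proof -
  obtain h where h: "\<And>q s. h (q \<cdot>\<^sub>H s) = h q \<cdot>\<^sub>O h s" "span {f1, f2, f3} = range h \<inter> ImO"
    using assms unfolding associative_plane_def quaternionic_subalgebra_def by auto
  have f: "f1 \<in> range h" "f2 \<in> range h" "f3 \<in> range h"
    using h(2) by (metis IntD1 insertCI span_base)+
  have "x \<cdot>\<^sub>O y \<in> range h" if "x \<in> range h" "y \<in> range h" for x y
    using that by (auto simp flip: h(1))
  then have g: "f2 \<cdot>\<^sub>O f3 \<in> range F" "f3 \<cdot>\<^sub>O f1 \<in> range F" "f1 \<cdot>\<^sub>O f2 \<in> range F"
    unfolding range_F h(2) using f products_ImO by auto
  obtain a where a: "f2 \<cdot>\<^sub>O f3 = F a" using g by auto
  have "F a \<bullet> f1 = a $ 1" "F a \<bullet> f2 = a $ 2" "F a \<bullet> f3 = a $ 3"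
    by (simp_all add: F_def inner_add_left unit orth orth')
  then have "a $ 1 = \<phi>" "a $ 2 = 0" "a $ 3 = 0"
    using inner_products(1) inner_products_0(1,2) by (simp_all add: a)
  then show "\<phi>\<^sup>2 = 1"
    using inner_products_products(1) by (simp add: a inner_F inner_vec_def sum_3 power2_eq_square)
  assume C: "C \<bullet> f1 = 0" "C \<bullet> f2 = 0" "C \<bullet> f3 = 0"
  then have "C \<bullet> y = 0" if "y \<in> range F" for y
    using that by (auto simp: F_def inner_add_right)
  then show "form_vector C = 0"
    using g by (simp add: form_vector_def vec_eq_iff forall_3)
qed

section \<open>The slant condition as a condition on unit vectors\<close>

text \<open>The unit vectors n parametrize the points, and the angle at a point is the same for all
  tangent vectors. Each tangent space is nonzero, so every n imposes its condition.\<close>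

lemma slant_round_sphere_iff:
  assumes C: "C \<in> ImO" "0 < r" and p: "\<And>n. norm n = 1 \<Longrightarrow> norm (C + r *\<^sub>R F n) = 1"
    and N: "N = (\<lambda>x. C + x) ` range F \<inter> sphere C r"
  shows "slant_with_angle N \<theta> \<longleftrightarrow> (\<forall>n. norm n = 1 \<longrightarrow> arccos \<bar>form_vector C \<bullet> n + r * \<phi>\<bar> = \<theta>)"
    and "norm n = 1 \<Longrightarrow> \<bar>form_vector C \<bullet> n + r * \<phi>\<bar> \<le> 1"
proof -
  have tangent: "\<exists>X. X \<in> tangent_space N (C + r *\<^sub>R F n) - {0}" if n: "norm n = 1" for n
  proof -
    have "n \<noteq> 0" using n by auto
    then obtain b where b: "cross3 n b \<noteq> 0" using cross_basis_nonzero by blast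
    have Fr: "r *\<^sub>R F n = F (r *\<^sub>R n)"
      using linear_F by (simp add: linear_scale)
    have "tangent_space N (C + r *\<^sub>R F n) = {v \<in> range F. v \<bullet> (r *\<^sub>R F n) = 0}"
      unfolding N Fr using C(2) n linear_F
      by (intro tangent_space_round_sphere) (simp_all add: linear_subspace_image norm_F)
    moreover have "F (cross3 n b) \<noteq> 0"
      using b by (metis norm_F norm_eq_zero)
    ultimately show ?thesis
      by (intro exI[of _ "F (cross3 n b)"]) (simp add: inner_F dot_cross_self inner_commute)
  qed
  have pN: "C + r *\<^sub>R F n \<in> N" if "norm n = 1" for n
    using that C(2) linear_F by (auto simp: N dist_norm norm_F linear_scale[symmetric])
  have Np: "\<exists>n. norm n = 1 \<and> q = C + r *\<^sub>R F n" if q: "q \<in> N" for q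
  proof -
    obtain x where x: "q = C + F x" "norm x = r"
      using q C(2) by (auto simp: N dist_norm norm_F)
    then show ?thesis
      using C(2) linear_F by (intro exI[of _ "x /\<^sub>R r"]) (simp add: linear_scale)
  qed
  note w = wirtinger_angle_round_sphere[OF C _ p N]
  show "norm n = 1 \<Longrightarrow> \<bar>form_vector C \<bullet> n + r * \<phi>\<bar> \<le> 1"
    using tangent w(2) by blast
  show "slant_with_angle N \<theta> \<longleftrightarrow> (\<forall>n. norm n = 1 \<longrightarrow> arccos \<bar>form_vector C \<bullet> n + r * \<phi>\<bar> = \<theta>)"
    unfolding slant_with_angle_def using tangent w(1) pN Np by metis
qed

end

section \<open>Great spheres, associative planes and centers of slant small spheres\<close>

theorem theorem3p1:
  fixes P' P :: "octo set" and C f1 f2 f3 :: octo and r :: real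
  assumes "affine P'" and "aff_dim P' = 3" and "P' \<subseteq> ImO"
    and "0 < r" and "r \<le> 1"
    and "C \<in> P'" and "P' \<inter> S6 = P' \<inter> sphere C r"
    and "subspace P" and "affine_parallel P' P"
    and "orthonormal_basis3 f1 f2 f3 P"
  shows
    "(P = P' \<longrightarrow>
        slant_with_angle (P' \<inter> S6) (arccos \<bar>assoc_form f1 f2 f3\<bar>) \<and>
        (\<not> associative_plane P \<longrightarrow>
           \<not> almost_complex (P' \<inter> S6) \<and>
           (assoc_form f1 f2 f3 \<noteq> 0 \<longrightarrow> proper_slant (P' \<inter> S6)))) \<and>
     (associative_plane P \<and> r < 1 \<longrightarrow>
        slant_with_angle (P' \<inter> S6) (arccos r)) \<and>
     (\<not> associative_plane P \<and> r < 1 \<longrightarrow>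
        (slant_with_angle (P' \<inter> S6) (arccos (r * \<bar>assoc_form f1 f2 f3\<bar>)) \<longleftrightarrow>
           C = (sqrt (1 - r\<^sup>2) / norm (associator f1 f2 f3)) *\<^sub>R associator f1 f2 f3 \<or>
           C = - ((sqrt (1 - r\<^sup>2) / norm (associator f1 f2 f3)) *\<^sub>R associator f1 f2 f3)))"
proof -
  have P'eq: "P' = (\<lambda>x. C + x) ` P"
  proof -
    obtain a where a: "P = (\<lambda>x. a + x) ` P'"
      using assms(9) by (auto simp: affine_parallel_def)
    have aC: "a + C \<in> P" using assms(6) a by blast
    show ?thesis
    proof (intro equalityI subsetI)
      fix x assume "x \<in> P'"
      then have "(a + x) - (a + C) \<in> P"
        using a aC subspace_diff[OF assms(8)] by blast
      then show "x \<in> (\<lambda>x. C + x) ` P"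
        by (intro image_eqI[of _ _ "(a + x) - (a + C)"]) auto
    next
      fix x assume "x \<in> (\<lambda>x. C + x) ` P"
      then obtain y where "y \<in> P" "x = C + y" by auto
      then have "a + x \<in> P"
        using subspace_add[OF assms(8) aC, of y] by (simp add: add.assoc)
      then show "x \<in> P'" using a by auto
    qed
  qed
  have CI: "C \<in> ImO" using assms(3,6) by auto
  have PI: "y \<in> ImO" if "y \<in> P" for y
    using that subspace_diff[OF subspace_ImO _ CI, of "C + y"] assms(3) P'eq by auto
  have onb: "norm f1 = 1" "norm f2 = 1" "norm f3 = 1" "f1 \<bullet> f2 = 0" "f1 \<bullet> f3 = 0" "f2 \<bullet> f3 = 0"
    and P: "P = span {f1, f2, f3}"
    using assms(10) by (auto simp: orthonormal_basis3_def)
  have fP: "f1 \<in> P" "f2 \<in> P" "f3 \<in> P"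
    unfolding P by (simp_all add: span_base)
  interpret orthonormal_ImO_triple f1 f2 f3
    using onb fP by unfold_locales (simp_all add: PI flip: norm_eq_1)
  define N where "N = P' \<inter> S6"
  have N: "N = (\<lambda>x. C + x) ` range F \<inter> sphere C r"
    unfolding N_def assms(7) using P'eq by (simp add: P range_F)
  have sphere: "norm (C + u) = 1" if "u \<in> P" "norm u = r" for u
  proof -
    have "C + u \<in> P' \<inter> sphere C r"
      using that by (simp add: P'eq dist_norm)
    then show ?thesis
      unfolding assms(7)[symmetric] by (simp add: S6_def)
  qed
  \<comment> \<open>The antipodal points C + r u and C - r u both have norm 1. Comparing the two
    expanded equations gives orthogonality and the norm of C.\<close>
  have ortho: "C \<bullet> u = 0 \<and> C \<bullet> C = 1 - r\<^sup>2" if u: "u \<in> P" "norm u = 1" for u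
  proof -
    have "r *\<^sub>R u \<in> P" "norm (r *\<^sub>R u) = r"
      using u assms(4,8) by (auto simp: subspace_mul)
    then have "norm (C + r *\<^sub>R u) = 1" "norm (C + - (r *\<^sub>R u)) = 1"
      by (intro sphere; simp add: subspace_neg[OF assms(8)])+
    then have "(C + r *\<^sub>R u) \<bullet> (C + r *\<^sub>R u) = 1" "(C + - (r *\<^sub>R u)) \<bullet> (C + - (r *\<^sub>R u)) = 1"
      by (simp_all only: norm_eq_1)
    moreover have "u \<bullet> u = 1" using u by (simp add: norm_eq_1)
    ultimately have "C \<bullet> C + 2 * r * (C \<bullet> u) + r\<^sup>2 = 1" "C \<bullet> C - 2 * r * (C \<bullet> u) + r\<^sup>2 = 1"
      by (simp_all add: inner_add_left inner_add_right inner_diff_left inner_diff_right inner_commute power2_eq_square)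
    then have "r * (C \<bullet> u) = 0" "C \<bullet> C = 1 - r\<^sup>2" by linarith+
    then show ?thesis using assms(4) by simp
  qed
  have Cf: "C \<bullet> f1 = 0" "C \<bullet> f2 = 0" "C \<bullet> f3 = 0" and CC: "C \<bullet> C = 1 - r\<^sup>2"
    using ortho fP onb by auto
  have p: "norm (C + r *\<^sub>R F n) = 1" if "norm n = 1" for n
    using that assms(4,8) range_F by (intro sphere) (auto simp: norm_F P intro: subspace_mul)
  have slant: "slant_with_angle N \<theta> \<longleftrightarrow> (\<forall>n. norm n = 1 \<longrightarrow> arccos \<bar>form_vector C \<bullet> n + r * \<phi>\<bar> = \<theta>)"
    and le_1: "norm n = 1 \<Longrightarrow> \<bar>form_vector C \<bullet> n + r * \<phi>\<bar> \<le> 1" for \<theta> n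
    by (rule slant_round_sphere_iff[OF CI assms(4) _ N]; simp add: p)+
  obtain e :: "real^3" where e: "norm e = 1" using vector_choose_size[of 1] by auto
  have center: "slant_with_angle N (arccos (r * \<bar>\<phi>\<bar>))" if "form_vector C = 0"
    using that assms(4) by (simp add: slant abs_mult)
  \<comment> \<open>A nonassociative plane excludes the slant angle 0, and nonzero
    \<open>\<phi>\<close> excludes pi / 2. For \<open>\<phi>\<close> = 0 the great sphere is totally
    real, so properness is claimed only for nonzero \<open>\<phi>\<close>.\<close>
  have a: "slant_with_angle N (arccos \<bar>\<phi>\<bar>) \<and>
      (\<not> associative_plane P \<longrightarrow> \<not> almost_complex N \<and> (\<phi> \<noteq> 0 \<longrightarrow> proper_slant N))" if "P = P'"
  proof -
    have "C \<in> span {f1, f2, f3}" using assms(6) that P by simp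
    then obtain c where c: "C = F c" by (auto simp flip: range_F)
    \<comment> \<open>C lies in the plane and is orthogonal to it.\<close>
    have "C = 0"
    proof -
      have "C \<bullet> C = c$1 * (C \<bullet> f1) + c$2 * (C \<bullet> f2) + c$3 * (C \<bullet> f3)"
        by (subst (2) c) (simp add: F_def inner_add_right)
      then show ?thesis using Cf by simp
    qed
    then have r1: "r = 1" and C0: "form_vector C = 0"
      using CC assms(4) by (auto simp: power2_eq_1_iff linear_0[OF linear_form_vector])
    have *: "slant_with_angle N \<theta> \<longleftrightarrow> arccos \<bar>\<phi>\<bar> = \<theta>" for \<theta>
      using e by (auto simp: slant r1 C0)
    have 1: "\<bar>\<phi>\<bar> \<le> 1" using le_1[OF e] by (simp add: r1 C0)
    have "arccos \<bar>\<phi>\<bar> \<noteq> 0" if "\<not> associative_plane P"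
    proof
      assume "arccos \<bar>\<phi>\<bar> = 0"
      then have "\<bar>\<phi>\<bar> = 1" using 1 cos_arccos_abs[of "\<bar>\<phi>\<bar>"] by simp
      then show False
        using that associative_plane_if_\<phi> P by (simp add: abs_square_eq_1 power2_eq_1_iff abs_eq_iff)
    qed
    moreover have "arccos \<bar>\<phi>\<bar> \<noteq> pi / 2" if "\<phi> \<noteq> 0"
    proof
      assume "arccos \<bar>\<phi>\<bar> = pi / 2"
      then have "cos (arccos \<bar>\<phi>\<bar>) = 0" by (simp only: cos_pi_half)
      then show False using that 1 by (simp add: cos_arccos_abs)
    qed
    ultimately show ?thesis
      unfolding proper_slant_def slant_def almost_complex_def totally_real_def * by blast
  qed
  have b: "slant_with_angle N (arccos r)" if "associative_plane P"
  proof -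
    have "\<phi>\<^sup>2 = 1" "form_vector C = 0" using associative_planeD that Cf unfolding P by blast+
    then show ?thesis using center by (auto simp: power2_eq_1_iff)
  qed
  have c: "slant_with_angle N (arccos (r * \<bar>\<phi>\<bar>)) \<longleftrightarrow>
           C = (sqrt (1 - r\<^sup>2) / norm (associator f1 f2 f3)) *\<^sub>R associator f1 f2 f3 \<or>
           C = - ((sqrt (1 - r\<^sup>2) / norm (associator f1 f2 f3)) *\<^sub>R associator f1 f2 f3)"
    (is "?L \<longleftrightarrow> C = ?C \<or> C = - ?C") if "\<not> associative_plane P"
  proof
    assume "C = ?C \<or> C = - ?C"
    then have "form_vector C = 0"
      by (auto simp: form_vector_associator simp flip: scaleR_minus_left)
    then show ?L by (rule center)
  next
    assume ?L
    have "\<bar>r * \<phi>\<bar> = r * \<bar>\<phi>\<bar>" using assms(4) by (simp add: abs_mult)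
    have eq: "\<bar>form_vector C \<bullet> n + r * \<phi>\<bar> = \<bar>r * \<phi>\<bar>" if n: "norm n = 1" for n
    proof -
      \<comment> \<open>The values at n and -n average to \<open>r * \<phi>\<close>.\<close>
      have "\<bar>r * \<phi>\<bar> \<le> 1"
        using le_1[of n] le_1[of "- n"] n by simp
      then show ?thesis
        using \<open>?L\<close> n le_1[OF n] assms(4) unfolding slant
        by (metis \<open>\<bar>r * \<phi>\<bar> = r * \<bar>\<phi>\<bar>\<close> abs_idempotent arccos_eq_iff)
    qed
    have "form_vector C = 0"
    proof (rule ccontr)
      assume nz: "form_vector C \<noteq> 0"
      \<comment> \<open>In this direction the affine function takes the values
        \<open>r * \<phi>\<close> plus and minus the norm of \<open>form_vector C\<close>. Both can
        have the absolute value of \<open>r * \<phi>\<close> only if that norm is zero.\<close>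
      define n where "n = form_vector C /\<^sub>R norm (form_vector C)"
      have n: "norm n = 1" using nz by (simp add: n_def)
      have "form_vector C \<bullet> n = norm (form_vector C)"
        using nz by (simp add: n_def dot_square_norm power2_eq_square)
      then show False using eq[OF n] eq[of "- n"] n nz by (simp split: if_splits add: abs_if)
    qed
    moreover have "\<phi>\<^sup>2 \<noteq> 1" using that associative_plane_if_\<phi> P by blast
    ultimately obtain k where k: "C = k *\<^sub>R associator f1 f2 f3"
      using eq_multiple_of_associator CI Cf by blast
    have "associator f1 f2 f3 \<noteq> 0"
      using norm_associator \<open>\<phi>\<^sup>2 \<noteq> 1\<close> by auto
    \<comment> \<open>The norm of C determines k up to sign, which gives the two possible
      centers.\<close>
    moreover have "norm C = sqrt (1 - r\<^sup>2)"
      using CC by (simp add: norm_eq_sqrt_inner)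
    ultimately have "\<bar>k\<bar> = sqrt (1 - r\<^sup>2) / norm (associator f1 f2 f3)"
      by (simp add: k field_simps)
    then have "k = sqrt (1 - r\<^sup>2) / norm (associator f1 f2 f3) \<or>
        - k = sqrt (1 - r\<^sup>2) / norm (associator f1 f2 f3)"
      by linarith
    then show "C = ?C \<or> C = - ?C"
      by (metis k scaleR_minus_left minus_minus)
  qed
  show ?thesis
    using a b c unfolding N_def by blast
qed

end
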